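(* Let $A$ be a closed linear operator on a Banach space $\mathfrak B$ over $\Omega=\Omega_p$, let $m\ge1$ be a natural number, and let $y_0,\dots,y_{m-1}\in\mathfrak B$. Consider the Cauchy problem $$y^{(m)}(z)=Ay(z),\qquad y^{(k)}(0)=y_k,\quad k=0,1,\dots,m-1. \qquad (\ast)$$ (1) Problem $(\ast)$ is solvable in the class $\mathfrak A_{loc}(\mathfrak B)$ if and only if $y_k\in E(A)$ for $k=0,1,\dots,m-1$. In this case the solution is represented in the form $$y(z)=\sum_{k=0}^{m-1}F_k(z;A)y_k,\qquad\text{where } F_k(z;A)x=\sum_{n=0}^\infty\frac{z^{mn+k}A^nx}{(mn+k)!}\quad (x\in E(A)).$$ (2) Moreover, problem $(\ast)$ is well-posed in $\mathfrak A_{loc}(\mathfrak B)$; that is, the solution is unique in this space, and if $y_{i,k},y_k\in E(A)$ and $y_{i,k}\to y_k$ as $i\to\infty$ in the topology of $E(A)$ for each $k=0,1,\dots,m-1$, then the solutions $y_i(z)$ of $(\ast)$ with initial data $y_{i,0},\dots,y_{i,m-1}$ converge in $\mathfrak A_{loc}(\mathfrak B)$ to the solution $y(z)$ of $(\ast)$ with initial data $y_0,\dots,y_{m-1}$.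
   Context: $p$ is a prime, and $\Omega=\Omega_p$ is the completion of an algebraic closure of the field $\mathbb Q_p$ of $p$-adic numbers, with $p$-adic absolute value $|\cdot|_p$ normalized by $|p|_p=1/p$. $\mathfrak B$ is a Banach space over $\Omega$ with (non-Archimedean) norm $\|\cdot\|$. $A$ is a closed linear operator on $\mathfrak B$ with domain $\mathcal D(A)\subseteq\mathfrak B$ (a linear subspace, not assumed to be all of $\mathfrak B$). $\mathbb N_0=\{0,1,2,\dots\}$. For $\alpha>0$, $E_\alpha(A)$ is the set of all $x\in\bigcap_{n\in\mathbb N_0}\mathcal D(A^n)$ for which there is $c=c(x)>0$ with $\|A^kx\|\le c\,\alpha^k$ for all $k\in\mathbb N_0$; it is a Banach space with norm $\|x\|_\alpha=\sup_{n\in\mathbb N_0}\|A^nx\|/\alpha^n$. The space of entire vectors of exponential type for $A$ is $E(A)=\bigcup_{\alpha>0}E_\alpha(A)$ with the (locally convex) inductive limit topology of the spaces $E_\alpha(A)$ as $\alpha\to\infty$. For a power series $y(z)=\sum_{n=0}^\infty c_nz^n$ with $c_n\in\mathfrak B$, $z\in\Omega$, the convergence radius is $r(y)=\bigl(\limsup_{n\to\infty}\sqrt[n]{\|c_n\|}\bigr)^{-1}\in[0,\infty]$, and if $r(y)>0$ it defines a $\mathfrak B$-valued function on $\{z\in\Omega:|z|_p<r(y)\}$. For $r>0$, $\mathfrak A_r(\mathfrak B)$ is the set of all such $y$ with $r(y)\ge r$ and $\lim_{i\to\infty}\|c_i\|r^i=0$; it is a Banach space with norm $\|y\|_r=\sup_{n\in\mathbb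 N_0}\|c_n\|r^n$. For $0<r_1<r$ there is a continuous embedding $\mathfrak A_r(\mathfrak B)\hookrightarrow\mathfrak A_{r_1}(\mathfrak B)$ by restriction. The space $\mathfrak A_{loc}(\mathfrak B)$ of $\mathfrak B$-valued functions locally analytic at zero is the (locally convex) inductive limit of the $\mathfrak A_r(\mathfrak B)$ as $r\to0$; as a set it is $\bigcup_{r>0}\mathfrak A_r(\mathfrak B)$. The derivatives are $y^{(i)}(z)=\sum_{n=0}^\infty(n+1)\cdots(n+i)c_{n+i}z^n$; one has $r(y^{(i)})\ge r(y)$. A solution of $(\ast)$ in $\mathfrak A_{loc}(\mathfrak B)$ is a function $y\in\mathfrak A_r(\mathfrak B)$, for some $r>0$, such that $y(z)\in\mathcal D(A)$ and $y^{(m)}(z)=Ay(z)$ for all $z$ with $|z|_p<r$, and $y^{(k)}(0)=y_k$ for $k=0,\dots,m-1$. *)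

theory Defs
  imports "HOL-Analysis.Analysis" "HOL-Computational_Algebra.Formal_Power_Series"
begin

text \<open>
  The library constant \<^const>\<open>norm\<close> is restricted to real vector spaces, so the ultrametric norm is a
  new class parameter; the topology and completeness are those of the induced metric.
\<close>

class ultranormed = ab_group_add + metric_space +
  fixes unorm :: "'a \<Rightarrow> real"
  assumes dist_unorm: "dist x y = unorm (x - y)"
    and unorm_add: "unorm (x + y) \<le> max (unorm x) (unorm y)"

text \<open>
  The type \<^typ>\<open>'k\<close> below plays the role of \<open>\<Omega>\<^sub>p\<close>, the completion of an algebraic closure of
  \<open>\<rat>\<^sub>p\<close>. An ultrametric absolute value with \<open>|p| = 1/p\<close> restricts to the \<open>p\<close>-adic absolute value
  on the prime field \<open>\<rat>\<close>. Since \<^typ>\<open>'k\<close> is complete, the closure of \<open>\<rat>\<close> in it is the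
  completion \<open>\<rat>\<^sub>p\<close>. If the subfield of elements algebraic over \<open>\<rat>\<^sub>p\<close> is algebraically closed, it
  is an algebraic closure of \<open>\<rat>\<^sub>p\<close>. If it is dense, then \<^typ>\<open>'k\<close> is its completion.
\<close>

definition Q_p :: "'k::{field_char_0,ultranormed,complete_space} set" where
  "Q_p = closure \<rat>"

definition Q_p_alg :: "'k::{field_char_0,ultranormed,complete_space} set" where
  "Q_p_alg = {x. \<exists>q. q \<noteq> 0 \<and> (\<forall>i. coeff q i \<in> Q_p) \<and> poly q x = 0}"

locale Omega_p =
  fixes p :: nat
    and Omega :: "'k::{field_char_0,ultranormed,complete_space} itself"
  assumes prime_p: "prime p"
    and unorm_mult: "unorm (a * b :: 'k) = unorm a * unorm b"
    and unorm_p: "unorm (of_nat p :: 'k) = 1 / real p"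
    and Q_p_alg_closed:
      "(\<And>i. coeff q i \<in> (Q_p_alg :: 'k set)) \<Longrightarrow> degree q > 0 \<Longrightarrow> \<exists>x\<in>Q_p_alg. poly q x = 0"
    and Q_p_alg_dense: "closure (Q_p_alg :: 'k set) = UNIV"

locale Omega_p_banach_space =
  Omega_p p "TYPE('k)" + vector_space smul
  for p :: nat
    and smul :: "'k::{field_char_0,ultranormed,complete_space} \<Rightarrow>
                  'b::{ultranormed,complete_space} \<Rightarrow> 'b" +
  assumes unorm_scale: "unorm (smul a x) = unorm a * unorm x"

text \<open>
  A partially defined operator is a pair of a domain \<open>D\<close> and a function \<open>A\<close> whose values outside
  \<open>D\<close> are irrelevant.
\<close>

definition closed_linear_operator ::
  "('k::field \<Rightarrow> 'b::{ab_group_add,topological_space} \<Rightarrow> 'b) \<Rightarrow> 'b set \<Rightarrow> ('b \<Rightarrow> 'b) \<Rightarrow> bool" where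
  "closed_linear_operator smul D A \<longleftrightarrow>
     module.subspace smul D \<and>
     (\<forall>x\<in>D. \<forall>y\<in>D. A (x + y) = A x + A y) \<and>
     (\<forall>a. \<forall>x\<in>D. A (smul a x) = smul a (A x)) \<and>
     closed {(x, A x) | x. x \<in> D}"

primrec power_domain :: "'b set \<Rightarrow> ('b \<Rightarrow> 'b) \<Rightarrow> nat \<Rightarrow> 'b set" where
  "power_domain D A 0 = UNIV"
| "power_domain D A (Suc n) = {x \<in> D. A x \<in> power_domain D A n}"


section \<open>Locally convex inductive limits\<close>

text \<open>
  The family \<open>V\<close> consists of subspaces of one ambient vector space, directed by inclusion, with
  norms \<open>N i\<close> on \<open>V i\<close>. Convexity is meant in the non-Archimedean sense: the absolutely convex
  sets are the submodules over the ring of scalars of norm at most one. A basic neighbourhood of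
  zero is an absolutely convex subset of the union whose intersection with every \<open>V i\<close> is a
  neighbourhood of zero there.
\<close>

definition abs_convex :: "('k::{field,ultranormed} \<Rightarrow> 'v::ab_group_add \<Rightarrow> 'v) \<Rightarrow> 'v set \<Rightarrow> bool" where
  "abs_convex smul U \<longleftrightarrow>
     0 \<in> U \<and> (\<forall>x\<in>U. \<forall>y\<in>U. \<forall>a b. unorm a \<le> 1 \<longrightarrow> unorm b \<le> 1 \<longrightarrow> smul a x + smul b y \<in> U)"

definition lc_nbhd0 ::
  "('k::{field,ultranormed} \<Rightarrow> 'v::ab_group_add \<Rightarrow> 'v) \<Rightarrow> 'i set \<Rightarrow> ('i \<Rightarrow> 'v set) \<Rightarrow>
   ('i \<Rightarrow> 'v \<Rightarrow> real) \<Rightarrow> 'v set \<Rightarrow> bool" where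
  "lc_nbhd0 smul I V N U \<longleftrightarrow>
     U \<subseteq> (\<Union>i\<in>I. V i) \<and> abs_convex smul U \<and>
     (\<forall>i\<in>I. \<exists>e>0. {v \<in> V i. N i v < e} \<subseteq> U)"

definition lc_inductive_limit ::
  "('k::{field,ultranormed} \<Rightarrow> 'v::ab_group_add \<Rightarrow> 'v) \<Rightarrow> 'i set \<Rightarrow> ('i \<Rightarrow> 'v set) \<Rightarrow>
   ('i \<Rightarrow> 'v \<Rightarrow> real) \<Rightarrow> 'v topology" where
  "lc_inductive_limit smul I V N =
     topology (\<lambda>S. S \<subseteq> (\<Union>i\<in>I. V i) \<and>
                   (\<forall>x\<in>S. \<exists>U. lc_nbhd0 smul I V N U \<and> (+) x ` U \<subseteq> S))"

lemma lc_nbhd0_Int: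
  assumes "lc_nbhd0 smul I V N U" "lc_nbhd0 smul I V N W"
  shows "lc_nbhd0 smul I V N (U \<inter> W)"
proof -
  have "\<exists>e>0. {v \<in> V i. N i v < e} \<subseteq> U \<inter> W" if i: "i \<in> I" for i
  proof -
    obtain e1 e2 where e: "e1 > 0" "{v \<in> V i. N i v < e1} \<subseteq> U" "e2 > 0" "{v \<in> V i. N i v < e2} \<subseteq> W"
      using assms i unfolding lc_nbhd0_def by meson
    then have "min e1 e2 > 0 \<and> {v \<in> V i. N i v < min e1 e2} \<subseteq> U \<inter> W"
      by auto
    then show ?thesis by blast
  qed
  then show ?thesis
    using assms by (auto simp: lc_nbhd0_def abs_convex_def)
qed

lemma openin_lc_inductive_limit:
  "openin (lc_inductive_limit smul I V N) S \<longleftrightarrow>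
     S \<subseteq> (\<Union>i\<in>I. V i) \<and> (\<forall>x\<in>S. \<exists>U. lc_nbhd0 smul I V N U \<and> (+) x ` U \<subseteq> S)"
proof -
  let ?P = "\<lambda>S. S \<subseteq> (\<Union>i\<in>I. V i) \<and> (\<forall>x\<in>S. \<exists>U. lc_nbhd0 smul I V N U \<and> (+) x ` U \<subseteq> S)"
  have int: "?P (S \<inter> T)" if S: "?P S" and T: "?P T" for S T
  proof (intro conjI ballI)
    fix x assume x: "x \<in> S \<inter> T"
    obtain U where U: "lc_nbhd0 smul I V N U" "(+) x ` U \<subseteq> S" using S x by blast
    obtain W where W: "lc_nbhd0 smul I V N W" "(+) x ` W \<subseteq> T" using T x by blast
    have "(+) x ` (U \<inter> W) \<subseteq> S \<inter> T" using U W by blast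
    then show "\<exists>U. lc_nbhd0 smul I V N U \<and> (+) x ` U \<subseteq> S \<inter> T"
      using lc_nbhd0_Int[OF U(1) W(1)] by blast
  qed (use S in auto)
  have un: "?P (\<Union>K)" if K: "\<forall>S\<in>K. ?P S" for K
  proof (intro conjI ballI)
    fix x assume "x \<in> \<Union>K"
    then obtain S where S: "S \<in> K" "x \<in> S" by blast
    then obtain U where "lc_nbhd0 smul I V N U" "(+) x ` U \<subseteq> S" using K by blast
    then show "\<exists>U. lc_nbhd0 smul I V N U \<and> (+) x ` U \<subseteq> \<Union>K" using S(1) by blast
  qed (use K in blast)
  have "istopology ?P"
    unfolding istopology_def using int un by blast
  then show ?thesis
    by (simp add: lc_inductive_limit_def topology_inverse')
qed

text \<open>
  The two lemmas below confirm that this is the finest locally convex topology for which all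
  inclusions of the \<open>V i\<close> are continuous. By linearity, continuity of the inclusions need only be
  required at zero.
\<close>

definition lc_cocone ::
  "('k::{field,ultranormed} \<Rightarrow> 'v::ab_group_add \<Rightarrow> 'v) \<Rightarrow> 'i set \<Rightarrow> ('i \<Rightarrow> 'v set) \<Rightarrow>
   ('i \<Rightarrow> 'v \<Rightarrow> real) \<Rightarrow> 'v topology \<Rightarrow> bool" where
  "lc_cocone smul I V N T \<longleftrightarrow>
     topspace T = (\<Union>i\<in>I. V i) \<and>
     (\<forall>x\<in>topspace T. continuous_map T T ((+) x)) \<and>
     (\<forall>S. openin T S \<longrightarrow> 0 \<in> S \<longrightarrow> (\<exists>U\<subseteq>S. openin T U \<and> abs_convex smul U)) \<and>
     (\<forall>i\<in>I. \<forall>S. openin T S \<longrightarrow> 0 \<in> S \<longrightarrow> (\<exists>e>0. {v \<in> V i. N i v < e} \<subseteq> S))"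

lemma lc_inductive_limit_finest:
  assumes "lc_cocone smul I V N T" "openin T S" and zero: "0 \<in> (\<Union>i\<in>I. V i)"
  shows "openin (lc_inductive_limit smul I V N) S"
  unfolding openin_lc_inductive_limit
proof (intro conjI ballI)
  have top: "topspace T = (\<Union>i\<in>I. V i)"
    using assms(1) by (simp add: lc_cocone_def)
  then show "S \<subseteq> (\<Union>i\<in>I. V i)"
    using openin_subset[OF assms(2)] by simp
  fix x assume x: "x \<in> S"
  then have xT: "x \<in> topspace T" using assms(2) openin_subset by blast
  then have "continuous_map T T ((+) x)"
    using assms(1) by (simp add: lc_cocone_def)
  then have "openin T {v \<in> topspace T. x + v \<in> S}"
    using assms(2) by (rule openin_continuous_map_preimage)
  moreover have "0 \<in> {v \<in> topspace T. x + v \<in> S}"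
    using zero x top by simp
  ultimately obtain U where U: "U \<subseteq> {v \<in> topspace T. x + v \<in> S}" "openin T U" "abs_convex smul U"
    using assms(1) unfolding lc_cocone_def by meson
  have "0 \<in> U" using U(3) by (simp add: abs_convex_def)
  then have "\<forall>i\<in>I. \<exists>e>0. {v \<in> V i. N i v < e} \<subseteq> U"
    using assms(1) U(2) unfolding lc_cocone_def by blast
  moreover have "U \<subseteq> (\<Union>i\<in>I. V i)"
    using U(1) top by blast
  ultimately have "lc_nbhd0 smul I V N U"
    using U(3) unfolding lc_nbhd0_def by blast
  then show "\<exists>U. lc_nbhd0 smul I V N U \<and> (+) x ` U \<subseteq> S"
    using U by blast
qed

lemma lc_cocone_lc_inductive_limit:
  assumes "vector_space smul" "module.subspace smul (\<Union>i\<in>I. V i)" "unorm (1 :: 'k) = 1"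
  shows "lc_cocone (smul :: 'k::{field,ultranormed} \<Rightarrow> _) I V N (lc_inductive_limit smul I V N)"
proof -
  interpret vector_space smul by fact
  define E where "E = (\<Union>i\<in>I. V i)"
  let ?T = "lc_inductive_limit smul I V N"
  have E: "subspace E" using assms(2) by (simp add: E_def)
  have "abs_convex smul E"
    using E unfolding abs_convex_def by (meson subspace_0 subspace_add subspace_scale)
  then have nE: "lc_nbhd0 smul I V N E"
    unfolding lc_nbhd0_def E_def by (auto intro: zero_less_one)
  have UE: "U \<subseteq> E" if "lc_nbhd0 smul I V N U" for U
    using that unfolding lc_nbhd0_def E_def by blast
  have top: "topspace ?T = E"
  proof
    show "topspace ?T \<subseteq> E"
      using openin_topspace[of ?T] unfolding openin_lc_inductive_limit E_def by blast
    have "openin ?T E"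
      using nE subspace_add[OF E] unfolding openin_lc_inductive_limit E_def[symmetric] by blast
    then show "E \<subseteq> topspace ?T" by (rule openin_subset)
  qed
  have nopen: "openin ?T U" if U: "lc_nbhd0 smul I V N U" for U
  proof -
    have "x + y \<in> U" if "x \<in> U" "y \<in> U" for x y
    proof -
      have "\<forall>a b. unorm a \<le> 1 \<longrightarrow> unorm b \<le> 1 \<longrightarrow> smul a x + smul b y \<in> U"
        using U that unfolding lc_nbhd0_def abs_convex_def by blast
      then have "smul 1 x + smul 1 y \<in> U" using assms(3) by (metis order_refl)
      then show ?thesis by simp
    qed
    then show ?thesis
      using U UE[OF U] unfolding openin_lc_inductive_limit E_def by blast
  qed
  have nb: "\<exists>U. lc_nbhd0 smul I V N U \<and> U \<subseteq> S" if "openin ?T S" "0 \<in> S" for S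
    using that unfolding openin_lc_inductive_limit by force
  have cont: "continuous_map ?T ?T ((+) x)" if x: "x \<in> E" for x
    unfolding continuous_map_def top
  proof (intro conjI allI impI)
    show "(+) x \<in> E \<rightarrow> E" using x subspace_add[OF E] by blast
    fix S assume S: "openin ?T S"
    show "openin ?T {v \<in> E. x + v \<in> S}"
      unfolding openin_lc_inductive_limit E_def[symmetric]
    proof (intro conjI ballI)
      fix v assume v: "v \<in> {v \<in> E. x + v \<in> S}"
      then obtain U where U: "lc_nbhd0 smul I V N U" "(+) (x + v) ` U \<subseteq> S"
        using S unfolding openin_lc_inductive_limit by blast
      have "(+) v ` U \<subseteq> {v \<in> E. x + v \<in> S}"
        using U(2) UE[OF U(1)] v subspace_add[OF E] by (auto simp: image_subset_iff add.assoc)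
      then show "\<exists>U. lc_nbhd0 smul I V N U \<and> (+) v ` U \<subseteq> {v \<in> E. x + v \<in> S}"
        using U(1) by blast
    qed blast
  qed
  show ?thesis
    unfolding lc_cocone_def top
  proof (intro conjI ballI allI impI)
    show "E = (\<Union>i\<in>I. V i)" by (fact E_def)
    show "continuous_map ?T ?T ((+) x)" if "x \<in> E" for x using that by (rule cont)
    show "\<exists>U\<subseteq>S. openin ?T U \<and> abs_convex smul U" if "openin ?T S" "0 \<in> S" for S
      using nb[OF that] nopen unfolding lc_nbhd0_def by meson
    show "\<exists>e>0. {v \<in> V i. N i v < e} \<subseteq> S" if "i \<in> I" "openin ?T S" "0 \<in> S" for i S
      using nb[OF that(2,3)] that(1) unfolding lc_nbhd0_def by (meson subset_trans)
  qed
qed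


section \<open>Entire vectors of exponential type\<close>

definition exp_space :: "'b::ultranormed set \<Rightarrow> ('b \<Rightarrow> 'b) \<Rightarrow> real \<Rightarrow> 'b set" where
  "exp_space D A \<alpha> =
     {x \<in> (\<Inter>n. power_domain D A n). \<exists>c>0. \<forall>k. unorm ((A ^^ k) x) \<le> c * \<alpha> ^ k}"

definition exp_norm :: "('b::ultranormed \<Rightarrow> 'b) \<Rightarrow> real \<Rightarrow> 'b \<Rightarrow> real" where
  "exp_norm A \<alpha> x = (SUP n. unorm ((A ^^ n) x) / \<alpha> ^ n)"

definition entire_vectors :: "'b::ultranormed set \<Rightarrow> ('b \<Rightarrow> 'b) \<Rightarrow> 'b set" where
  "entire_vectors D A = (\<Union>\<alpha>\<in>{0<..}. exp_space D A \<alpha>)"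

definition entire_vectors_topology ::
  "('k::{field,ultranormed} \<Rightarrow> 'b::ultranormed \<Rightarrow> 'b) \<Rightarrow> 'b set \<Rightarrow> ('b \<Rightarrow> 'b) \<Rightarrow> 'b topology" where
  "entire_vectors_topology smul D A =
     lc_inductive_limit smul {0<..} (exp_space D A) (exp_norm A)"


section \<open>Vector-valued functions locally analytic at zero\<close>

text \<open>
  A power series is represented by its coefficients, as an element of \<^typ>\<open>'b fps\<close>. Formal power
  series over a vector space have no library scalar multiplication, evaluation or derivative;
  \<open>fps_deriv\<close> needs a ring of coefficients.
\<close>

definition series_scale :: "('k \<Rightarrow> 'b \<Rightarrow> 'b) \<Rightarrow> 'k \<Rightarrow> 'b fps \<Rightarrow> 'b fps" where
  "series_scale smul a y = Abs_fps (\<lambda>n. smul a (fps_nth y n))"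

definition series_eval ::
  "('k::field \<Rightarrow> 'b::{ab_group_add,t2_space} \<Rightarrow> 'b) \<Rightarrow> 'b fps \<Rightarrow> 'k \<Rightarrow> 'b" where
  "series_eval smul y z = (\<Sum>n. smul (z ^ n) (fps_nth y n))"

definition series_deriv :: "('k::field \<Rightarrow> 'b \<Rightarrow> 'b) \<Rightarrow> nat \<Rightarrow> 'b fps \<Rightarrow> 'b fps" where
  "series_deriv smul i y =
     Abs_fps (\<lambda>n. smul (\<Prod>j=1..i. of_nat (n + j)) (fps_nth y (n + i)))"

text \<open>
  \<^const>\<open>conv_radius\<close> requires coefficients in a real Banach space, but depends only on their norms.
\<close>

definition series_radius :: "'b::ultranormed fps \<Rightarrow> ereal" where
  "series_radius y = conv_radius (\<lambda>n. unorm (fps_nth y n))"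

definition analytic_space :: "real \<Rightarrow> 'b::ultranormed fps set" where
  "analytic_space r =
     {y. series_radius y \<ge> ereal r \<and> (\<lambda>n. unorm (fps_nth y n) * r ^ n) \<longlonglongrightarrow> 0}"

definition analytic_norm :: "real \<Rightarrow> 'b::ultranormed fps \<Rightarrow> real" where
  "analytic_norm r y = (SUP n. unorm (fps_nth y n) * r ^ n)"

text \<open>The limit as \<open>r\<close> tends to zero: the spaces grow as \<open>r\<close> decreases.\<close>

definition locally_analytic_topology ::
  "('k::{field,ultranormed} \<Rightarrow> 'b::ultranormed \<Rightarrow> 'b) \<Rightarrow> 'b fps topology" where
  "locally_analytic_topology smul =
     lc_inductive_limit (series_scale smul) {0<..} analytic_space analytic_norm"


section \<open>The Cauchy problem\<close>

definition cauchy_solution_on ::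
  "('k::{field,ultranormed} \<Rightarrow> 'b::ultranormed \<Rightarrow> 'b) \<Rightarrow>
   'b set \<Rightarrow> ('b \<Rightarrow> 'b) \<Rightarrow> nat \<Rightarrow> (nat \<Rightarrow> 'b) \<Rightarrow> real \<Rightarrow> 'b fps \<Rightarrow> bool" where
  "cauchy_solution_on smul D A m y0 r y \<longleftrightarrow>
     r > 0 \<and> y \<in> analytic_space r \<and>
     (\<forall>z. unorm z < r \<longrightarrow>
        series_eval smul y z \<in> D \<and>
        series_eval smul (series_deriv smul m y) z = A (series_eval smul y z)) \<and>
     (\<forall>k<m. series_eval smul (series_deriv smul k y) 0 = y0 k)"

definition cauchy_solution ::
  "('k::{field,ultranormed} \<Rightarrow> 'b::ultranormed \<Rightarrow> 'b) \<Rightarrow>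
   'b set \<Rightarrow> ('b \<Rightarrow> 'b) \<Rightarrow> nat \<Rightarrow> (nat \<Rightarrow> 'b) \<Rightarrow> 'b fps \<Rightarrow> bool" where
  "cauchy_solution smul D A m y0 y \<longleftrightarrow> (\<exists>r. cauchy_solution_on smul D A m y0 r y)"

definition F_term ::
  "('k::{field,semiring_char_0} \<Rightarrow> 'b \<Rightarrow> 'b) \<Rightarrow> ('b \<Rightarrow> 'b) \<Rightarrow> nat \<Rightarrow> nat \<Rightarrow> 'k \<Rightarrow> 'b \<Rightarrow> nat \<Rightarrow> 'b" where
  "F_term smul A m k z x n = smul (z ^ (m * n + k) / fact (m * n + k)) ((A ^^ n) x)"

definition F_series ::
  "('k::{field,semiring_char_0} \<Rightarrow> 'b::{ab_group_add,t2_space} \<Rightarrow> 'b) \<Rightarrow> ('b \<Rightarrow> 'b) \<Rightarrow>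
   nat \<Rightarrow> nat \<Rightarrow> 'k \<Rightarrow> 'b \<Rightarrow> 'b" where
  "F_series smul A m k z x = (\<Sum>n. F_term smul A m k z x n)"

end

theory Submission
  imports Defs
begin

text \<open>
  Everything happens at the level of coefficients. For \<open>y = \<Sum>c\<^sub>n z\<^sup>n\<close> in some \<open>\<AA>\<^sub>r\<close>, the equation
  \<open>y\<^sup>(\<^sup>m\<^sup>) = A y\<close> with values of \<open>y\<close> in \<open>D\<close> on the disc \<open>|z| < r\<close> is equivalent to \<open>c\<^sub>n \<in> D\<close> and
  \<open>A c\<^sub>n = (n + 1) \<dots> (n + m) c\<^sub>n\<^sub>+\<^sub>m\<close> for all \<open>n\<close> (\<open>cauchy_solution_on_iff\<close>). One direction applies \<open>A\<close>
  to partial sums and passes to the limit by closedness. The other one extracts coefficients: letting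
  \<open>z\<close> tend to zero yields the constant coefficients, again by closedness, and
  \<open>(y(z) - c\<^sub>0) / z\<close> is a power series with the same property
  (\<open>coeffs_of_closed_operator_identity\<close>).

  The recursion forces \<open>c\<^sub>N = A\<^sup>n y\<^sub>k / N!\<close> for \<open>N = m n + k\<close>, \<open>k < m\<close>. This gives uniqueness, and the
  formula for the solution after grouping its terms by their index modulo \<open>m\<close>. What remains is to
  compare two growth conditions: \<open>A\<^sup>n y\<^sub>k = N! c\<^sub>N\<close> grows at most geometrically because
  \<open>|N!| \<le> 1\<close>, so the initial values of a solution are entire vectors; and conversely
  \<open>1 / |N!| \<le> p\<^sup>N\<close> (\<open>unorm_inverse_fact_le\<close>), so dividing \<open>A\<^sup>n x\<close> by \<open>N!\<close> preserves geometric growth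
  and every tuple of entire vectors generates a series with a positive radius of convergence.

  The same estimate, made uniform in \<open>x\<close>, sends each \<open>E\<^sub>\<alpha>(A)\<close> boundedly into one \<open>\<AA>\<^sub>r\<close>
  (\<open>propagator_bound\<close>). Hence the preimage of a basic neighbourhood of zero under the linear map
  \<open>x \<mapsto> F\<^sub>k(\<sqdot>;A) x\<close> is a basic neighbourhood of zero, which is continuity between the inductive limits.
\<close>

section \<open>Ultrametric groups\<close>

lemma unorm_zero [simp]: "unorm (0 :: 'a::ultranormed) = 0"
  using dist_unorm[of "0::'a" 0] by simp

lemma unorm_nonneg [simp]: "0 \<le> unorm (x :: 'a::ultranormed)"
  using dist_unorm[of x 0] zero_le_dist[of x 0] by simp

lemma unorm_eq_0_iff [simp]: "unorm (x :: 'a::ultranormed) = 0 \<longleftrightarrow> x = 0"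
  using dist_unorm[of x 0] dist_eq_0_iff[of x 0] by simp

lemma unorm_minus [simp]: "unorm (- x :: 'a::ultranormed) = unorm x"
  using dist_unorm[of x 0] dist_unorm[of 0 x] by (simp add: dist_commute)

lemma unorm_triangle: "unorm (x + y :: 'a::ultranormed) \<le> unorm x + unorm y"
  using unorm_add[of x y] unorm_nonneg[of x] unorm_nonneg[of y] by linarith

lemma unorm_sum_le:
  fixes f :: "'i \<Rightarrow> 'a::ultranormed"
  assumes "\<And>i. i \<in> F \<Longrightarrow> unorm (f i) \<le> B" "0 \<le> B"
  shows "unorm (sum f F) \<le> B"
  using assms
proof (induction F rule: infinite_finite_induct)
  case (insert i F)
  then have "max (unorm (f i)) (unorm (sum f F)) \<le> B" by simp
  from order_trans[OF unorm_add this] show ?case using insert.hyps by simp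
qed auto

text \<open>Limits and series in an ultrametric group thereby obey the general laws for sums.\<close>

instance ultranormed \<subseteq> topological_ab_group_add
proof
  fix a b :: 'a
  show "((\<lambda>x. fst x + snd x) \<longlongrightarrow> a + b) (nhds a \<times>\<^sub>F nhds b)"
  proof (rule tendstoI)
    fix e :: real assume "e > 0"
    then have "eventually (\<lambda>x. dist x a < e) (nhds a)" "eventually (\<lambda>y. dist y b < e) (nhds b)"
      by (simp_all add: eventually_nhds_metric) blast+
    then have "eventually (\<lambda>x. dist (fst x) a < e \<and> dist (snd x) b < e) (nhds a \<times>\<^sub>F nhds b)"
      unfolding eventually_prod_filter by auto
    then show "eventually (\<lambda>x. dist (fst x + snd x) (a + b) < e) (nhds a \<times>\<^sub>F nhds b)"
    proof eventually_elim
      case (elim x)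
      have "unorm ((fst x - a) + (snd x - b)) < e"
        using elim unorm_add[of "fst x - a" "snd x - b"] by (simp only: dist_unorm) linarith
      moreover have "fst x + snd x - (a + b) = (fst x - a) + (snd x - b)" by simp
      ultimately show ?case by (simp only: dist_unorm)
    qed
  qed
  show "(uminus \<longlongrightarrow> - a) (nhds a)"
  proof (rule tendstoI)
    fix e :: real assume "e > 0"
    then have "eventually (\<lambda>x. dist x a < e) (nhds a)"
      by (auto simp: eventually_nhds_metric)
    moreover have "dist (- x) (- a) = dist x a" for x :: 'a
      using unorm_minus[of "x - a"] by (simp add: dist_unorm)
    ultimately show "eventually (\<lambda>x. dist (- x) (- a) < e) (nhds a)" by simp
  qed
qed

lemma tendsto_iff_unorm_diff:
  fixes f :: "'i \<Rightarrow> 'a::ultranormed"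
  shows "(f \<longlongrightarrow> l) F \<longleftrightarrow> ((\<lambda>i. unorm (f i - l)) \<longlongrightarrow> 0) F"
  by (simp add: tendsto_dist_iff[of f l] dist_unorm)

lemma tendsto_unorm:
  fixes f :: "'i \<Rightarrow> 'a::ultranormed"
  assumes "(f \<longlongrightarrow> l) F"
  shows "((\<lambda>i. unorm (f i)) \<longlongrightarrow> unorm l) F"
  using tendsto_dist[OF assms tendsto_const[of 0]] by (simp add: dist_unorm)

text \<open>
  By the ultrametric inequality a block of the series is no larger than its largest term.
\<close>

lemma summable_if_unorm_tendsto_0:
  fixes f :: "nat \<Rightarrow> 'a::{ultranormed,complete_space}"
  assumes "(\<lambda>n. unorm (f n)) \<longlonglongrightarrow> 0"
  shows "summable f"
proof -
  have "Cauchy (\<lambda>n. sum f {..<n})"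
  proof (rule CauchyI')
    fix e :: real assume "e > 0"
    then obtain M where M: "\<And>n. n \<ge> M \<Longrightarrow> unorm (f n) < e / 2"
      using order_tendstoD(2)[OF assms, of "e / 2"] by (auto simp: eventually_sequentially)
    have "dist (sum f {..<m}) (sum f {..<n}) < e" if "m \<ge> M" "m < n" for m n
    proof -
      have "sum f {..<n} - sum f {..<m} = sum f {m..<n}"
        using that sum_diff_nat_ivl[of 0 m n f] by (simp add: atLeast0LessThan)
      moreover have "unorm (sum f {m..<n}) \<le> e / 2"
        using M that \<open>e > 0\<close> by (intro unorm_sum_le) (auto intro: less_imp_le)
      ultimately show ?thesis
        using \<open>e > 0\<close> by (subst dist_commute) (simp add: dist_unorm)
    qed
    then show "\<exists>M. \<forall>m\<ge>M. \<forall>n>m. dist (sum f {..<m}) (sum f {..<n}) < e" by blast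
  qed
  then show ?thesis
    by (simp add: Cauchy_convergent_iff summable_iff_convergent)
qed

lemma unorm_suminf_le:
  fixes f :: "nat \<Rightarrow> 'a::ultranormed"
  assumes "summable f" "\<And>n. unorm (f n) \<le> B"
  shows "unorm (suminf f) \<le> B"
proof -
  have "0 \<le> B" using assms(2)[of 0] unorm_nonneg order_trans by blast
  then have "unorm (sum f {..<n}) \<le> B" for n
    using assms(2) by (intro unorm_sum_le)
  then show ?thesis
    using tendsto_unorm[OF summable_LIMSEQ[OF assms(1)]] by (intro LIMSEQ_le_const2) auto
qed

section \<open>Absolute values of factorials\<close>

context Omega_p
begin

lemma unorm_one [simp]: "unorm (1 :: 'k) = 1"
  using unorm_mult[of 1 1] unorm_eq_0_iff[of "1 :: 'k"] by simp

lemma unorm_power: "unorm (a ^ n :: 'k) = unorm a ^ n"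
  by (induction n) (simp_all add: unorm_mult)

lemma unorm_of_nat_le_1: "unorm (of_nat n :: 'k) \<le> 1"
proof (induction n)
  case (Suc n)
  then show ?case using unorm_add[of "1 :: 'k" "of_nat n"] by simp
qed simp

lemma unorm_of_int_le_1: "unorm (of_int n :: 'k) \<le> 1"
  by (cases n rule: int_cases2) (simp_all add: unorm_of_nat_le_1)

text \<open>A Bezout relation \<open>u p + v n = 1\<close> excludes \<open>|n| < 1\<close>, because \<open>|p| < 1\<close>.\<close>

lemma unorm_of_nat_coprime:
  assumes "\<not> p dvd n"
  shows "unorm (of_nat n :: 'k) = 1"
proof -
  have "coprime (int p) (int n)"
    using prime_imp_coprime[OF prime_p assms] by simp
  then obtain u v :: int where "u * int p + v * int n = 1"
    using bezout_int[of "int p" "int n"] by (auto simp: coprime_iff_gcd_eq_1)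
  then have "of_int (u * int p + v * int n) = (1 :: 'k)" by simp
  then have "1 \<le> max (unorm (of_int u * of_nat p :: 'k)) (unorm (of_int v * of_nat n :: 'k))"
    using unorm_add[of "of_int u * of_nat p :: 'k" "of_int v * of_nat n"] by simp
  moreover have "unorm (of_int u * of_nat p :: 'k) \<le> unorm (of_nat p :: 'k)"
    using mult_right_mono[OF unorm_of_int_le_1[of u], of "unorm (of_nat p :: 'k)"] by (simp add: unorm_mult)
  moreover have "unorm (of_nat p :: 'k) < 1"
    using prime_gt_1_nat[OF prime_p] by (simp add: unorm_p)
  moreover have "unorm (of_int v * of_nat n :: 'k) \<le> unorm (of_nat n :: 'k)"
    using mult_right_mono[OF unorm_of_int_le_1[of v], of "unorm (of_nat n :: 'k)"] by (simp add: unorm_mult)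
  ultimately show ?thesis using unorm_of_nat_le_1[of n] by linarith
qed

text \<open>
  Among \<open>1, \<dots>, n\<close> only the multiples of \<open>p\<close> fail to be units, and dividing them by \<open>p\<close> leaves
  \<open>1, \<dots>, n div p\<close>. This is one step of Legendre's formula.
\<close>

lemma unorm_fact_div:
  "unorm (fact n :: 'k) = (1 / real p) ^ (n div p) * unorm (fact (n div p) :: 'k)"
proof (induction n)
  case (Suc n)
  have step: "unorm (fact (Suc n) :: 'k) = unorm (of_nat (Suc n) :: 'k) * unorm (fact n :: 'k)"
    for n by (simp only: fact_Suc unorm_mult of_nat_mult)
  show ?case
  proof (cases "p dvd Suc n")
    case True
    then have q: "Suc n div p = Suc (n div p)" by (simp add: div_Suc dvd_eq_mod_eq_0)
    then have "Suc n = p * Suc (n div p)"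
      using True by (metis dvd_mult_div_cancel)
    then have "unorm (of_nat (Suc n) :: 'k) = 1 / real p * unorm (of_nat (Suc (n div p)) :: 'k)"
      by (metis of_nat_mult unorm_mult unorm_p)
    then show ?thesis
      unfolding q step Suc.IH by simp
  next
    case False
    then show ?thesis
      using Suc.IH step[of n] unorm_of_nat_coprime[OF False] by (simp add: div_Suc dvd_eq_mod_eq_0)
  qed
qed simp

text \<open>
  Legendre's step gives \<open>v(n!) = q + v(q!)\<close> with \<open>q = n div p\<close>, so inductively \<open>v(n!) \<le> 2 q \<le> n\<close>.
  The sharp exponent \<open>n / (p - 1)\<close> would change only the radius of convergence obtained later, not
  its positivity.
\<close>

lemma unorm_fact_ge: "(1 / real p) ^ n \<le> unorm (fact n :: 'k)"
proof (induction n rule: less_induct)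
  case (less n)
  have p: "p > 1" using prime_gt_1_nat[OF prime_p] .
  show ?case
  proof (cases "n = 0")
    case False
    then have "n div p < n" using p by simp
    from less[OF this] have "(1 / real p) ^ (n div p) * (1 / real p) ^ (n div p) \<le> unorm (fact n :: 'k)"
      unfolding unorm_fact_div[of n] by (intro mult_left_mono) auto
    moreover have "n div p + n div p \<le> n"
    proof -
      have "n div p \<le> n div 2" using p by (intro div_le_mono2) auto
      then show ?thesis by linarith
    qed
    then have "(1 / real p) ^ n \<le> (1 / real p) ^ (n div p + n div p)"
      using p by (intro power_decreasing) auto
    ultimately show ?thesis by (simp add: power_add)
  qed simp
qed

lemma unorm_inverse_fact_le: "unorm (1 / fact n :: 'k) \<le> real p ^ n"
proof -
  have p: "real p > 0" using prime_gt_0_nat[OF prime_p] by simp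
  have "unorm (1 / fact n :: 'k) * unorm (fact n :: 'k) = 1"
    by (simp flip: unorm_mult)
  moreover have "unorm (1 / fact n :: 'k) * (1 / real p) ^ n \<le> unorm (1 / fact n :: 'k) * unorm (fact n :: 'k)"
    by (intro mult_left_mono unorm_fact_ge unorm_nonneg)
  ultimately show ?thesis
    using p by (simp add: power_divide field_simps)
qed

lemma unorm_fact_le_1: "unorm (fact n :: 'k) \<le> 1"
  using unorm_of_nat_le_1[of "fact n"] by simp

end

section \<open>Power series with vector coefficients\<close>

text \<open>
  The decay of the coefficients already bounds the radius of convergence from below, so membership
  reduces to it.
\<close>

lemma analytic_space_iff:
  assumes "r > 0"
  shows "y \<in> analytic_space r \<longleftrightarrow> (\<lambda>n. unorm (fps_nth y n) * r ^ n) \<longlonglongrightarrow> 0"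
proof -
  have "ereal r \<le> series_radius y" if lim: "(\<lambda>n. unorm (fps_nth y n) * r ^ n) \<longlonglongrightarrow> 0"
    unfolding series_radius_def
  proof (rule conv_radius_geI_ex')
    fix s assume s: "0 < s" "ereal s < ereal r"
    obtain K where K: "\<And>n. norm (unorm (fps_nth y n) * r ^ n) \<le> K"
      using convergent_imp_Bseq[of "\<lambda>n. unorm (fps_nth y n) * r ^ n"] lim
      unfolding convergent_def Bseq_def by blast
    have "norm (unorm (fps_nth y n) * s ^ n) \<le> K * (s / r) ^ n" for n
    proof -
      have "unorm (fps_nth y n) * s ^ n = (unorm (fps_nth y n) * r ^ n) * (s / r) ^ n"
        using assms by (simp add: power_divide)
      moreover have "(unorm (fps_nth y n) * r ^ n) * (s / r) ^ n \<le> K * (s / r) ^ n"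
        using K[of n] s assms by (intro mult_right_mono) auto
      ultimately have "unorm (fps_nth y n) * s ^ n \<le> K * (s / r) ^ n" by (simp only:)
      then show ?thesis using s by simp
    qed
    moreover have "summable (\<lambda>n. K * (s / r) ^ n)"
      using s by (intro summable_mult summable_geometric) auto
    ultimately have "summable (\<lambda>n. unorm (fps_nth y n) * s ^ n)"
      by (rule summable_comparison_test'[rotated])
    then show "summable (\<lambda>n. unorm (fps_nth y n) * of_real s ^ n)" by simp
  qed
  then show ?thesis by (auto simp: analytic_space_def)
qed

text \<open>
  The offset \<open>j\<close> covers the operations that move coefficients to the left: removal of initial terms
  and differentiation.
\<close>

lemma analytic_space_dominated:
  assumes "0 < r" "y \<in> analytic_space r" "0 < s"
    and "\<And>n. unorm (fps_nth x n) * s ^ n \<le> K * (unorm (fps_nth y (n + j)) * r ^ (n + j))"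
  shows "x \<in> analytic_space s"
proof -
  have "(\<lambda>n. K * (unorm (fps_nth y (n + j)) * r ^ (n + j))) \<longlonglongrightarrow> 0"
    using assms(1,2) LIMSEQ_ignore_initial_segment[of "\<lambda>n. unorm (fps_nth y n) * r ^ n" 0 j]
    by (intro tendsto_mult_right_zero) (simp add: analytic_space_iff)
  then have "(\<lambda>n. unorm (fps_nth x n) * s ^ n) \<longlonglongrightarrow> 0"
    by (rule tendsto_sandwich[OF _ _ tendsto_const, rotated 2])
      (use assms in \<open>auto intro!: always_eventually\<close>)
  then show ?thesis using assms by (simp add: analytic_space_iff)
qed

lemma analytic_space_antimono:
  assumes "0 < s" "s \<le> r" "y \<in> analytic_space r"
  shows "y \<in> analytic_space s"
  by (rule analytic_space_dominated[of r y s y 1 0])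
    (use assms in \<open>auto intro!: mult_left_mono power_mono\<close>)

lemma analytic_spaceI_geometric:
  assumes "0 < r" "\<And>n. unorm (fps_nth y n) * r ^ n \<le> C * (1 / 2) ^ n"
  shows "y \<in> analytic_space r"
proof -
  have "(\<lambda>n. C * (1 / 2 :: real) ^ n) \<longlonglongrightarrow> 0"
    by (intro tendsto_mult_right_zero LIMSEQ_power_zero) simp
  then have "(\<lambda>n. unorm (fps_nth y n) * r ^ n) \<longlonglongrightarrow> 0"
    by (rule tendsto_sandwich[OF _ _ tendsto_const, rotated 2])
      (use assms in \<open>auto intro!: always_eventually\<close>)
  then show ?thesis using assms(1) by (simp add: analytic_space_iff)
qed

lemma fps_shift_analytic_space:
  assumes "0 < r" "y \<in> analytic_space r"
  shows "fps_shift j y \<in> analytic_space r"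
  by (rule analytic_space_dominated[of r y r _ "1 / r ^ j" j])
    (use assms in \<open>auto simp: power_add\<close>)

lemma analytic_space_bounded:
  assumes "0 < r" "y \<in> analytic_space r"
  obtains K where "0 < K" "\<And>n. unorm (fps_nth y n) * r ^ n \<le> K"
proof -
  have "(\<lambda>n. unorm (fps_nth y n) * r ^ n) \<longlonglongrightarrow> 0"
    using assms by (simp add: analytic_space_iff)
  from convergent_imp_Bseq[OF convergentI[OF this]]
  obtain K where "0 < K" "\<forall>n. norm (unorm (fps_nth y n) * r ^ n) \<le> K"
    unfolding Bseq_def by blast
  then show thesis by (intro that[of K]) (auto dest: abs_le_D1)
qed

context Omega_p_banach_space
begin

lemma tendsto_smul:
  assumes "(f \<longlongrightarrow> l) F"
  shows "((\<lambda>i. smul a (f i)) \<longlongrightarrow> smul a l) F"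
proof -
  have "unorm (smul a (f i) - smul a l) = unorm a * unorm (f i - l)" for i
    by (simp add: unorm_scale flip: scale_right_diff_distrib)
  then show ?thesis
    using assms by (simp add: tendsto_iff_unorm_diff[of _ "smul a l"] tendsto_iff_unorm_diff[of f]
        tendsto_mult_right_zero)
qed

lemma sums_smul:
  assumes "f sums s"
  shows "(\<lambda>n. smul a (f n)) sums smul a s"
  using tendsto_smul[of _ s sequentially a] assms by (simp add: sums_def flip: scale_sum_right)

lemma unorm_series_term_le:
  assumes "unorm z \<le> r"
  shows "unorm (smul (z ^ n) (fps_nth y n)) \<le> unorm (fps_nth y n) * r ^ n"
  using assms by (auto simp: unorm_scale unorm_power mult.commute[of "_ ^ n"]
      intro!: mult_left_mono power_mono)

lemma unorm_series_term_tendsto_0: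
  assumes "0 < r" "y \<in> analytic_space r" "unorm z \<le> r"
  shows "(\<lambda>n. unorm (smul (z ^ n) (fps_nth y n))) \<longlonglongrightarrow> 0"
  by (rule tendsto_sandwich[of "\<lambda>_. 0" _ _ "\<lambda>n. unorm (fps_nth y n) * r ^ n"])
    (use assms unorm_series_term_le in \<open>auto simp: analytic_space_iff intro!: always_eventually\<close>)

lemma series_sums:
  assumes "0 < r" "y \<in> analytic_space r" "unorm z \<le> r"
  shows "(\<lambda>n. smul (z ^ n) (fps_nth y n)) sums series_eval smul y z"
  unfolding series_eval_def
  by (intro summable_sums summable_if_unorm_tendsto_0 unorm_series_term_tendsto_0[OF assms])

lemma series_eval_zero [simp]: "series_eval smul y 0 = fps_nth y 0"
proof -
  have "series_eval smul y 0 = (\<Sum>n\<in>{0}. smul (0 ^ n) (fps_nth y n))"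
    unfolding series_eval_def by (rule suminf_finite) auto
  then show ?thesis by simp
qed

lemma series_eval_shift:
  assumes "0 < r" "y \<in> analytic_space r" "unorm z \<le> r"
  shows "series_eval smul y z = fps_nth y 0 + smul z (series_eval smul (fps_shift 1 y) z)"
proof -
  have "(\<lambda>n. smul z (smul (z ^ n) (fps_nth (fps_shift 1 y) n)))
          sums smul z (series_eval smul (fps_shift 1 y) z)"
    using assms by (intro sums_smul series_sums[of r] fps_shift_analytic_space)
  then have "(\<lambda>n. smul (z ^ Suc n) (fps_nth y (Suc n))) sums smul z (series_eval smul (fps_shift 1 y) z)"
    by simp
  from sums_Suc[OF this] have "(\<lambda>n. smul (z ^ n) (fps_nth y n)) sums
      (smul z (series_eval smul (fps_shift 1 y) z) + smul (z ^ 0) (fps_nth y 0))" .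
  from sums_unique2[OF this series_sums[OF assms]] show ?thesis by (simp add: add.commute)
qed

text \<open>
  The remainder after the constant term is \<open>z\<close> times a series whose values are bounded on the disc.
\<close>

lemma series_eval_tendsto_at_0:
  assumes "0 < r" "y \<in> analytic_space r" and z: "\<And>i. unorm (z i) \<le> r" "(\<lambda>i. unorm (z i)) \<longlonglongrightarrow> 0"
  shows "(\<lambda>i. series_eval smul y (z i)) \<longlonglongrightarrow> fps_nth y 0"
proof -
  let ?x = "fps_shift 1 y"
  have x: "?x \<in> analytic_space r" using assms by (intro fps_shift_analytic_space)
  obtain K where K: "\<And>n. unorm (fps_nth ?x n) * r ^ n \<le> K"
    using analytic_space_bounded[OF assms(1) x] by blast
  have bound: "unorm (series_eval smul y (z i) - fps_nth y 0) \<le> unorm (z i) * K" for i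
  proof -
    have "unorm (series_eval smul ?x (z i)) \<le> K"
      unfolding series_eval_def
    proof (rule unorm_suminf_le)
      show "summable (\<lambda>n. smul (z i ^ n) (fps_nth ?x n))"
        using series_sums[OF assms(1) x z(1)] by (rule sums_summable)
      show "unorm (smul (z i ^ n) (fps_nth ?x n)) \<le> K" for n
        by (rule order_trans[OF unorm_series_term_le[OF z(1)] K])
    qed
    then show ?thesis
      by (simp add: series_eval_shift[OF assms(1,2) z(1)] unorm_scale mult_left_mono)
  qed
  have "(\<lambda>i. unorm (series_eval smul y (z i) - fps_nth y 0)) \<longlonglongrightarrow> 0"
    by (rule tendsto_sandwich[of "\<lambda>_. 0" _ _ "\<lambda>i. unorm (z i) * K"])
      (auto simp: bound intro: tendsto_mult_left_zero[OF z(2)])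
  then show ?thesis
    by (simp only: tendsto_iff_unorm_diff[of _ "fps_nth y 0"])
qed

lemma series_deriv_analytic_space:
  assumes "0 < r" "y \<in> analytic_space r"
  shows "series_deriv smul i y \<in> analytic_space r"
proof (rule analytic_space_dominated[of r y r _ "1 / r ^ i" i])
  fix n
  have "unorm (\<Prod>j=1..i. of_nat (n + j) :: 'k) \<le> 1"
    using unorm_of_nat_le_1[of "\<Prod>j=1..i. n + j"] by simp
  then have "unorm (fps_nth (series_deriv smul i y) n) \<le> unorm (fps_nth y (n + i))"
    by (simp add: series_deriv_def unorm_scale mult_left_le_one_le)
  then show "unorm (fps_nth (series_deriv smul i y) n) * r ^ n
      \<le> 1 / r ^ i * (unorm (fps_nth y (n + i)) * r ^ (n + i))"
    using assms(1) by (simp add: power_add mult_right_mono)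
qed (use assms in auto)

lemma series_deriv_at_0: "series_eval smul (series_deriv smul k y) 0 = smul (fact k) (fps_nth y k)"
  by (simp add: series_deriv_def fact_prod)

lemma smul_fact_series_deriv:
  "smul (fact n) (fps_nth (series_deriv smul i y) n) = smul (fact (n + i)) (fps_nth y (n + i))"
proof -
  have "fact (n + i) = (fact n * (\<Prod>j=1..i. of_nat (n + j)) :: 'k)"
    by (induction i) (simp_all add: algebra_simps)
  then show ?thesis by (simp add: series_deriv_def)
qed

end

section \<open>Solutions through their coefficients\<close>

locale p_adic_cauchy_problem = Omega_p_banach_space p smul
  for p :: nat
    and smul :: "'k::{field_char_0,ultranormed,complete_space} \<Rightarrow>
                  'b::{ultranormed,complete_space} \<Rightarrow> 'b" +
  fixes D :: "'b set" and A :: "'b \<Rightarrow> 'b" and m :: nat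
  assumes closed_op: "closed_linear_operator smul D A"
    and m_pos: "m \<ge> 1"
begin

lemma subspace_D: "subspace D"
  using closed_op by (simp add: closed_linear_operator_def)

lemma A_add: "x \<in> D \<Longrightarrow> y \<in> D \<Longrightarrow> A (x + y) = A x + A y"
  using closed_op by (simp add: closed_linear_operator_def)

lemma A_smul: "x \<in> D \<Longrightarrow> A (smul a x) = smul a (A x)"
  using closed_op by (simp add: closed_linear_operator_def)

lemma A_zero [simp]: "A 0 = 0"
  using A_smul[OF subspace_0[OF subspace_D], of 0] by simp

lemma A_diff: "x \<in> D \<Longrightarrow> y \<in> D \<Longrightarrow> A (x - y) = A x - A y"
  using A_add[of x "smul (- 1) y"] A_smul[of y "- 1"] subspace_scale[OF subspace_D, of y "- 1"]
  by simp

lemma A_sum: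
  assumes "\<And>i. i \<in> F \<Longrightarrow> f i \<in> D"
  shows "A (sum f F) = (\<Sum>i\<in>F. A (f i))"
  using assms
  by (induction F rule: infinite_finite_induct) (simp_all add: A_add subspace_sum[OF subspace_D])

lemma closed_graph_limit:
  assumes "\<And>i. x i \<in> D" "x \<longlonglongrightarrow> l" "(\<lambda>i. A (x i)) \<longlonglongrightarrow> w"
  shows "l \<in> D \<and> A l = w"
proof -
  have "closed {(x, A x) | x. x \<in> D}"
    using closed_op by (simp add: closed_linear_operator_def)
  moreover have "(\<lambda>i. (x i, A (x i))) \<longlonglongrightarrow> (l, w)"
    using assms(2,3) by (rule tendsto_Pair)
  ultimately have "(l, w) \<in> {(x, A x) | x. x \<in> D}"
    using assms(1) by (intro closed_sequentially[of _ "\<lambda>i. (x i, A (x i))" "(l, w)"]) auto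
  then show ?thesis by auto
qed

text \<open>
  Power series are continuous at zero, so the values at points tending to zero converge on both sides
  and closedness of \<open>A\<close> applies to their limits.
\<close>

lemma constant_coeff_of_closed_operator_identity:
  assumes "0 < r" "y \<in> analytic_space r" "u \<in> analytic_space r"
    and "\<And>z. z \<noteq> 0 \<Longrightarrow> unorm z < r \<Longrightarrow>
           series_eval smul y z \<in> D \<and> A (series_eval smul y z) = series_eval smul u z"
  shows "fps_nth y 0 \<in> D \<and> A (fps_nth y 0) = fps_nth u 0"
proof -
  have p: "real p > 1" using prime_gt_1_nat[OF prime_p] by simp
  have norm_pow: "unorm (of_nat p ^ i :: 'k) = (1 / real p) ^ i" for i
    by (simp add: unorm_power unorm_p)
  have lim: "(\<lambda>i. (1 / real p) ^ i) \<longlonglongrightarrow> 0"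
    using p by (intro LIMSEQ_power_zero) simp
  then obtain N where N: "\<And>i. i \<ge> N \<Longrightarrow> (1 / real p) ^ i < r"
    using order_tendstoD(2)[OF lim assms(1)] by (auto simp: eventually_sequentially)
  (* The valuation is nontrivial: powers of p are nonzero points of the disc tending to 0. *)
  define z :: "nat \<Rightarrow> 'k" where "z i = of_nat p ^ (i + N)" for i
  have z: "z i \<noteq> 0" "unorm (z i) < r" for i
    using N[of "i + N"] p by (auto simp: z_def norm_pow)
  have z_lim: "(\<lambda>i. unorm (z i)) \<longlonglongrightarrow> 0"
    unfolding z_def norm_pow by (rule LIMSEQ_ignore_initial_segment[OF lim])
  have "(\<lambda>i. series_eval smul y (z i)) \<longlonglongrightarrow> fps_nth y 0"
    "(\<lambda>i. series_eval smul u (z i)) \<longlonglongrightarrow> fps_nth u 0"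
    using series_eval_tendsto_at_0[OF assms(1) _ less_imp_le[OF z(2)] z_lim] assms(2,3) by blast+
  then show ?thesis
    using assms(4)[OF z] by (intro closed_graph_limit[of "\<lambda>i. series_eval smul y (z i)"]) auto
qed

text \<open>
  Removing the constant coefficients and dividing by \<open>z\<close> leaves power series with the same property,
  and the claim for constant coefficients applies again. The hypothesis is restricted to \<open>z \<noteq> 0\<close>
  because the division preserves it only there.
\<close>

lemma coeffs_of_closed_operator_identity:
  assumes "0 < r" "y \<in> analytic_space r" "u \<in> analytic_space r"
    and "\<And>z. z \<noteq> 0 \<Longrightarrow> unorm z < r \<Longrightarrow>
           series_eval smul y z \<in> D \<and> A (series_eval smul y z) = series_eval smul u z"
  shows "fps_nth y n \<in> D \<and> A (fps_nth y n) = fps_nth u n"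
  using assms(2-4)
proof (induction n arbitrary: y u)
  case (0 y u)
  show ?case by (rule constant_coeff_of_closed_operator_identity[OF assms(1) 0])
next
  case (Suc n y u)
  have zero: "fps_nth y 0 \<in> D \<and> A (fps_nth y 0) = fps_nth u 0"
    using constant_coeff_of_closed_operator_identity[OF assms(1) Suc.prems] .
  have "fps_nth (fps_shift 1 y) n \<in> D \<and> A (fps_nth (fps_shift 1 y) n) = fps_nth (fps_shift 1 u) n"
  proof (rule Suc.IH)
    fix z :: 'k assume z: "z \<noteq> 0" "unorm z < r"
    have "series_eval smul (fps_shift 1 x) z = smul (1 / z) (series_eval smul x z - fps_nth x 0)"
      if "x \<in> analytic_space r" for x
      using series_eval_shift[OF assms(1) that less_imp_le[OF z(2)]] z(1) by simp
    then show "series_eval smul (fps_shift 1 y) z \<in> D \<and>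
        A (series_eval smul (fps_shift 1 y) z) = series_eval smul (fps_shift 1 u) z"
      using Suc.prems(1,2) Suc.prems(3)[OF z] zero
      by (simp add: A_smul A_diff subspace_diff[OF subspace_D] subspace_scale[OF subspace_D])
  qed (use Suc.prems assms(1) in \<open>auto intro: fps_shift_analytic_space\<close>)
  then show ?case by simp
qed

text \<open>
  This removes the variable \<open>z\<close> from the problem. From right to left, \<open>A\<close> is applied to partial sums
  of \<open>y(z)\<close>, and both these and their images converge, so closedness of \<open>A\<close> yields the equation.
\<close>

lemma cauchy_solution_on_iff:
  "cauchy_solution_on smul D A m y0 r y \<longleftrightarrow>
     r > 0 \<and> y \<in> analytic_space r \<and>
     (\<forall>n. fps_nth y n \<in> D \<and> A (fps_nth y n) = fps_nth (series_deriv smul m y) n) \<and>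
     (\<forall>k<m. smul (fact k) (fps_nth y k) = y0 k)"
proof -
  have "series_eval smul y z \<in> D \<and>
        series_eval smul (series_deriv smul m y) z = A (series_eval smul y z)"
    if r: "r > 0" "y \<in> analytic_space r" and z: "unorm z < r"
      and c: "\<And>n. fps_nth y n \<in> D" "\<And>n. A (fps_nth y n) = fps_nth (series_deriv smul m y) n" for z
  proof -
    let ?S = "\<lambda>n. \<Sum>i<n. smul (z ^ i) (fps_nth y i)"
    have "?S n \<in> D" for n
      by (intro subspace_sum subspace_scale subspace_D c)
    moreover have "?S \<longlonglongrightarrow> series_eval smul y z"
      using series_sums[OF r less_imp_le[OF z]] by (simp add: sums_def)
    moreover have "A (?S n) = (\<Sum>i<n. smul (z ^ i) (fps_nth (series_deriv smul m y) i))" for n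
      by (simp add: A_sum A_smul c subspace_scale[OF subspace_D])
    then have "(\<lambda>n. A (?S n)) \<longlonglongrightarrow> series_eval smul (series_deriv smul m y) z"
      using series_sums[OF r(1) series_deriv_analytic_space[OF r] less_imp_le[OF z]]
      by (simp add: sums_def)
    ultimately have "series_eval smul y z \<in> D \<and>
        A (series_eval smul y z) = series_eval smul (series_deriv smul m y) z"
      by (rule closed_graph_limit)
    then show ?thesis by simp
  qed
  moreover have "fps_nth y n \<in> D \<and> A (fps_nth y n) = fps_nth (series_deriv smul m y) n"
    if "cauchy_solution_on smul D A m y0 r y" for n
    using that by (intro coeffs_of_closed_operator_identity[of r])
      (auto simp: cauchy_solution_on_def intro: series_deriv_analytic_space)
  ultimately show ?thesis
    unfolding cauchy_solution_on_def series_deriv_at_0 by blast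
qed

text \<open>
  Unwinding the recursion \<open>m\<close> coefficients at a time: the products \<open>(N + 1) \<dots> (N + m)\<close> accumulate to
  a factorial.
\<close>

lemma funpow_initial_value:
  assumes "cauchy_solution_on smul D A m y0 r y" "k < m"
  shows "(A ^^ n) (y0 k) = smul (fact (m * n + k)) (fps_nth y (m * n + k))"
proof (induction n)
  case (Suc n)
  have c: "fps_nth y i \<in> D" "A (fps_nth y i) = fps_nth (series_deriv smul m y) i" for i
    using assms(1) by (simp_all add: cauchy_solution_on_iff)
  have "(A ^^ Suc n) (y0 k) = smul (fact (m * n + k)) (fps_nth (series_deriv smul m y) (m * n + k))"
    by (simp add: Suc.IH A_smul c)
  then show ?case
    by (simp add: smul_fact_series_deriv algebra_simps)
qed (use assms in \<open>simp add: cauchy_solution_on_iff\<close>)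

end

section \<open>Vectors of exponential type\<close>

lemma mem_power_domain_iff: "x \<in> power_domain D A n \<longleftrightarrow> (\<forall>i<n. (A ^^ i) x \<in> D)"
  by (induction n arbitrary: x) (simp_all add: All_less_Suc2 funpow_Suc_right del: funpow.simps)

lemma mem_exp_space_iff:
  "x \<in> exp_space D A \<alpha> \<longleftrightarrow>
     (\<forall>n. (A ^^ n) x \<in> D) \<and> (\<exists>c>0. \<forall>k. unorm ((A ^^ k) x) \<le> c * \<alpha> ^ k)"
  by (auto simp: exp_space_def mem_power_domain_iff)

lemma exp_space_mono:
  assumes "0 < \<alpha>" "\<alpha> \<le> \<beta>"
  shows "exp_space D A \<alpha> \<subseteq> exp_space D A \<beta>"
proof
  fix x assume x: "x \<in> exp_space D A \<alpha>"
  then obtain c where c: "c > 0" "\<And>k. unorm ((A ^^ k) x) \<le> c * \<alpha> ^ k"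
    by (auto simp: mem_exp_space_iff)
  have "unorm ((A ^^ k) x) \<le> c * \<beta> ^ k" for k
  proof -
    have "c * \<alpha> ^ k \<le> c * \<beta> ^ k"
      using c(1) assms by (intro mult_left_mono power_mono) auto
    with c(2)[of k] show ?thesis by linarith
  qed
  with c(1) x show "x \<in> exp_space D A \<beta>" by (auto simp: mem_exp_space_iff)
qed

lemma unorm_funpow_le_exp_norm:
  assumes "0 < \<alpha>" "x \<in> exp_space D A \<alpha>"
  shows "unorm ((A ^^ n) x) \<le> exp_norm A \<alpha> x * \<alpha> ^ n"
proof -
  obtain c where c: "\<And>k. unorm ((A ^^ k) x) \<le> c * \<alpha> ^ k"
    using assms by (auto simp: mem_exp_space_iff)
  then have "bdd_above (range (\<lambda>n. unorm ((A ^^ n) x) / \<alpha> ^ n))"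
    using assms(1) by (intro bdd_aboveI2[of _ _ c]) (simp add: divide_le_eq)
  then have "unorm ((A ^^ n) x) / \<alpha> ^ n \<le> exp_norm A \<alpha> x"
    unfolding exp_norm_def by (intro cSUP_upper) auto
  then show ?thesis using assms(1) by (simp add: divide_le_eq)
qed

context p_adic_cauchy_problem
begin

lemma funpow_linear:
  assumes "\<And>n. (A ^^ n) x \<in> D" "\<And>n. (A ^^ n) y \<in> D"
  shows "(A ^^ n) (smul a x + smul b y) = smul a ((A ^^ n) x) + smul b ((A ^^ n) y)"
  by (induction n) (simp_all add: assms A_add A_smul subspace_scale[OF subspace_D])

lemma subspace_entire_vectors: "subspace (entire_vectors D A)"
proof -
  have lin: "smul a x + smul b y \<in> entire_vectors D A"
    if "x \<in> entire_vectors D A" "y \<in> entire_vectors D A" for a b x y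
  proof -
    obtain \<alpha> \<beta> where ab: "0 < \<alpha>" "0 < \<beta>" "x \<in> exp_space D A \<alpha>" "y \<in> exp_space D A \<beta>"
      using \<open>x \<in> _\<close> \<open>y \<in> _\<close> by (auto simp: entire_vectors_def)
    define \<gamma> where "\<gamma> = max \<alpha> \<beta>"
    have g: "0 < \<gamma>" "x \<in> exp_space D A \<gamma>" "y \<in> exp_space D A \<gamma>"
      using ab exp_space_mono[of \<alpha> \<gamma> D A] exp_space_mono[of \<beta> \<gamma> D A] by (auto simp: \<gamma>_def)
    obtain c d where cd: "c > 0" "\<And>k. unorm ((A ^^ k) x) \<le> c * \<gamma> ^ k"
        "d > 0" "\<And>k. unorm ((A ^^ k) y) \<le> d * \<gamma> ^ k"
      using g by (auto simp: mem_exp_space_iff)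
    have dom: "(A ^^ n) x \<in> D" "(A ^^ n) y \<in> D" for n
      using g by (auto simp: mem_exp_space_iff)
    have "unorm ((A ^^ k) (smul a x + smul b y)) \<le> (unorm a * c + unorm b * d + 1) * \<gamma> ^ k" for k
    proof -
      have "unorm ((A ^^ k) (smul a x + smul b y))
          \<le> unorm a * unorm ((A ^^ k) x) + unorm b * unorm ((A ^^ k) y)"
        using unorm_triangle[of "smul a ((A ^^ k) x)" "smul b ((A ^^ k) y)"]
        by (simp add: funpow_linear[OF dom] unorm_scale)
      also have "\<dots> \<le> unorm a * (c * \<gamma> ^ k) + unorm b * (d * \<gamma> ^ k)"
        by (intro add_mono mult_left_mono cd unorm_nonneg)
      also have "\<dots> \<le> (unorm a * c + unorm b * d + 1) * \<gamma> ^ k"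
        using g(1) by (simp add: algebra_simps)
      finally show ?thesis .
    qed
    moreover have "unorm a * c + unorm b * d + 1 > 0"
      using cd by (intro add_nonneg_pos add_nonneg_nonneg mult_nonneg_nonneg) auto
    moreover have "(A ^^ n) (smul a x + smul b y) \<in> D" for n
      by (simp add: funpow_linear[OF dom] dom subspace_add[OF subspace_D] subspace_scale[OF subspace_D])
    ultimately have "smul a x + smul b y \<in> exp_space D A \<gamma>"
      unfolding mem_exp_space_iff by blast
    then show ?thesis using g(1) by (auto simp: entire_vectors_def)
  qed
  have funpow_zero: "(A ^^ n) 0 = 0" for n by (induction n) simp_all
  have "0 \<in> exp_space D A 1"
    unfolding mem_exp_space_iff funpow_zero using subspace_0[OF subspace_D] by (auto intro: exI[of _ 1])
  then have "0 \<in> entire_vectors D A" by (auto simp: entire_vectors_def)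
  then show ?thesis
    unfolding subspace_def using lin[of _ _ 1 1] lin[of _ 0 _ 0] by simp
qed

lemma entire_vector_funpow_mem: "x \<in> entire_vectors D A \<Longrightarrow> (A ^^ n) x \<in> D"
  by (auto simp: entire_vectors_def mem_exp_space_iff)

text \<open>
  The factor \<open>N!\<close> in \<open>A\<^sup>n y\<^sub>k = N! c\<^sub>N\<close> has norm at most one, so the geometric bound on \<open>c\<^sub>N\<close> passes to
  \<open>A\<^sup>n y\<^sub>k\<close>. With \<open>N = m n + k\<close> the type is at most \<open>r\<^sup>-\<^sup>m\<close>.
\<close>

lemma initial_value_entire:
  assumes sol: "cauchy_solution_on smul D A m y0 r y" and k: "k < m"
  shows "y0 k \<in> entire_vectors D A"
proof -
  have r: "r > 0" "y \<in> analytic_space r" and c: "fps_nth y n \<in> D" for n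
    using sol by (simp_all add: cauchy_solution_on_iff)
  obtain K where K: "K > 0" "\<And>n. unorm (fps_nth y n) * r ^ n \<le> K"
    using analytic_space_bounded[OF r] by blast
  have "unorm ((A ^^ n) (y0 k)) \<le> (K / r ^ k) * (1 / r ^ m) ^ n" for n
  proof -
    have "unorm ((A ^^ n) (y0 k)) \<le> unorm (fps_nth y (m * n + k))"
      by (simp add: funpow_initial_value[OF sol k] unorm_scale mult_left_le_one_le unorm_fact_le_1)
    also have "\<dots> \<le> K / r ^ (m * n + k)"
      using K(2)[of "m * n + k"] r(1) by (simp add: le_divide_eq)
    also have "\<dots> = (K / r ^ k) * (1 / r ^ m) ^ n"
      by (simp add: power_add power_mult power_divide)
    finally show ?thesis .
  qed
  moreover have "(A ^^ n) (y0 k) \<in> D" for n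
    by (simp add: funpow_initial_value[OF sol k] c subspace_scale[OF subspace_D])
  ultimately have "y0 k \<in> exp_space D A (1 / r ^ m)"
    unfolding mem_exp_space_iff using K(1) r(1) by (metis divide_pos_pos zero_less_power)
  then show ?thesis
    unfolding entire_vectors_def using r(1) by (intro UN_I[of "1 / r ^ m"]) auto
qed

section \<open>The fundamental solutions\<close>

text \<open>The power series of \<open>z \<mapsto> F\<^sub>k(z;A) x\<close>, which is supported on the indices \<open>m n + k\<close>.\<close>

definition propagator :: "nat \<Rightarrow> 'b \<Rightarrow> 'b fps" where
  "propagator k x =
     Abs_fps (\<lambda>N. if N mod m = k then smul (1 / fact N) ((A ^^ (N div m)) x) else 0)"

lemma propagator_linear:
  assumes "x \<in> entire_vectors D A" "y \<in> entire_vectors D A"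
  shows "propagator k (smul a x + smul b y)
       = series_scale smul a (propagator k x) + series_scale smul b (propagator k y)"
  using assms
  by (simp add: fps_eq_iff propagator_def series_scale_def funpow_linear entire_vector_funpow_mem
      scale_right_distrib scale_left_commute[of a] scale_left_commute[of b])

lemma propagator_diff:
  assumes "x \<in> entire_vectors D A" "y \<in> entire_vectors D A"
  shows "propagator k (x - y) = propagator k x - propagator k y"
  using propagator_linear[OF assms, of k 1 "- 1"]
  by (simp add: fps_eq_iff series_scale_def)

text \<open>
  The radius depends on \<open>\<alpha>\<close> alone. This uniformity in \<open>x\<close> is what continuity of the propagators
  rests on; the factor \<open>2\<^sup>-\<^sup>n\<close> yields membership in the space of that radius.
\<close>

lemma propagator_bound:
  assumes "0 < \<alpha>"
  obtains r where "0 < r"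
    "\<And>k x n. x \<in> exp_space D A \<alpha> \<Longrightarrow>
       unorm (fps_nth (propagator k x) n) * r ^ n \<le> exp_norm A \<alpha> x * (1 / 2) ^ n"
proof
  have p: "real p > 0" using prime_gt_0_nat[OF prime_p] by simp
  (* For alpha < 1 the exponent n div m could not be raised to n. *)
  define \<beta> where "\<beta> = max 1 \<alpha>"
  have \<beta>: "\<beta> \<ge> 1" "\<alpha> \<le> \<beta>" by (auto simp: \<beta>_def)
  (* p compensates 1 / n! and beta compensates A^(n div m), where n div m <= n; 2 leaves a margin. *)
  define r where "r = 1 / (2 * real p * \<beta>)"
  show "0 < r" using p \<beta> by (simp add: r_def)
  fix k x n assume x: "x \<in> exp_space D A \<alpha>"
  have "0 \<le> exp_norm A \<alpha> x"
    using order_trans[OF unorm_nonneg unorm_funpow_le_exp_norm[OF assms x, of 0]] by simp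
  then have "unorm (fps_nth (propagator k x) n) \<le> real p ^ n * (exp_norm A \<alpha> x * \<beta> ^ n)"
  proof -
    have "\<alpha> ^ (n div m) \<le> \<beta> ^ (n div m)"
      using assms \<beta> by (intro power_mono) auto
    also have "\<dots> \<le> \<beta> ^ n"
      using \<beta> by (intro power_increasing) auto
    finally have "exp_norm A \<alpha> x * \<alpha> ^ (n div m) \<le> exp_norm A \<alpha> x * \<beta> ^ n"
      using \<open>0 \<le> exp_norm A \<alpha> x\<close> by (rule mult_left_mono)
    with unorm_funpow_le_exp_norm[OF assms x, of "n div m"]
    have "unorm ((A ^^ (n div m)) x) \<le> exp_norm A \<alpha> x * \<beta> ^ n" by simp
    then have "unorm (1 / fact n :: 'k) * unorm ((A ^^ (n div m)) x)
        \<le> real p ^ n * (exp_norm A \<alpha> x * \<beta> ^ n)"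
      using p by (intro mult_mono unorm_inverse_fact_le) auto
    moreover have "0 \<le> real p ^ n * (exp_norm A \<alpha> x * \<beta> ^ n)"
      using \<open>0 \<le> exp_norm A \<alpha> x\<close> p \<beta> by simp
    ultimately show ?thesis by (simp add: propagator_def unorm_scale)
  qed
  then have "unorm (fps_nth (propagator k x) n) * r ^ n
      \<le> real p ^ n * (exp_norm A \<alpha> x * \<beta> ^ n) * r ^ n"
    using \<open>0 < r\<close> by (intro mult_right_mono) auto
  also have "\<dots> = exp_norm A \<alpha> x * (real p * \<beta> * r) ^ n"
    by (simp add: power_mult_distrib)
  also have "real p * \<beta> * r = 1 / 2"
    using p \<beta> by (simp add: r_def)
  finally show "unorm (fps_nth (propagator k x) n) * r ^ n \<le> exp_norm A \<alpha> x * (1 / 2) ^ n" .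
qed

lemma propagator_mem_analytic_space:
  assumes "x \<in> entire_vectors D A"
  shows "propagator k x \<in> (\<Union>r\<in>{0<..}. analytic_space r)"
proof -
  obtain \<alpha> where a: "0 < \<alpha>" "x \<in> exp_space D A \<alpha>"
    using assms by (auto simp: entire_vectors_def)
  obtain r where "0 < r"
      "\<And>n. unorm (fps_nth (propagator k x) n) * r ^ n \<le> exp_norm A \<alpha> x * (1 / 2) ^ n"
    using propagator_bound[OF a(1)] a(2) by metis
  then show ?thesis using analytic_spaceI_geometric by blast
qed

lemma vector_space_series: "vector_space (series_scale smul)"
  by standard (simp_all add: fps_eq_iff series_scale_def scale_right_distrib scale_left_distrib)

lemma subspace_locally_analytic:
  "module.subspace (series_scale smul) (\<Union>r\<in>{0<..}. analytic_space r)"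
proof -
  interpret S: vector_space "series_scale smul" by (rule vector_space_series)
  show ?thesis
  proof (rule S.subspaceI)
    show "0 \<in> (\<Union>r\<in>{0<..}. analytic_space r :: 'b fps set)"
      by (rule UN_I[of 1]) (simp_all add: analytic_space_iff)
  next
    fix x y :: "'b fps"
    assume "x \<in> (\<Union>r\<in>{0<..}. analytic_space r)" "y \<in> (\<Union>r\<in>{0<..}. analytic_space r)"
    then obtain r s where rs: "0 < r" "0 < s" "x \<in> analytic_space r" "y \<in> analytic_space s" by auto
    define t where "t = min r s"
    have t: "0 < t" "x \<in> analytic_space t" "y \<in> analytic_space t"
      using rs analytic_space_antimono[of t r x] analytic_space_antimono[of t s y]
      by (auto simp: t_def)
    have lim: "(\<lambda>n. unorm (fps_nth x n) * t ^ n + unorm (fps_nth y n) * t ^ n) \<longlonglongrightarrow> 0"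
      using t by (intro tendsto_add_zero) (simp_all add: analytic_space_iff)
    have bound: "unorm (fps_nth (x + y) n) * t ^ n
        \<le> unorm (fps_nth x n) * t ^ n + unorm (fps_nth y n) * t ^ n" for n
      using mult_right_mono[OF unorm_triangle[of "fps_nth x n" "fps_nth y n"], of "t ^ n"] t(1)
      by (simp add: distrib_right)
    have "(\<lambda>n. unorm (fps_nth (x + y) n) * t ^ n) \<longlonglongrightarrow> 0"
      by (rule Lim_null_comparison[OF _ lim])
        (use t(1) bound in \<open>simp add: abs_mult del: fps_add_nth\<close>)
    then show "x + y \<in> (\<Union>r\<in>{0<..}. analytic_space r)"
      using t(1) by (intro UN_I[of t]) (simp_all add: analytic_space_iff)
  next
    fix a and x :: "'b fps" assume "x \<in> (\<Union>r\<in>{0<..}. analytic_space r)"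
    then obtain r where r: "0 < r" "x \<in> analytic_space r" by auto
    have "series_scale smul a x \<in> analytic_space r"
      by (rule analytic_space_dominated[of r x r _ "unorm a" 0])
        (use r in \<open>auto simp: series_scale_def unorm_scale\<close>)
    then show "series_scale smul a x \<in> (\<Union>r\<in>{0<..}. analytic_space r)" using r by auto
  qed
qed

lemma fps_nth_sum_propagator:
  "fps_nth (\<Sum>k<m. propagator k (y0 k)) n = smul (1 / fact n) ((A ^^ (n div m)) (y0 (n mod m)))"
  using m_pos by (simp add: fps_sum_nth propagator_def)

lemma solution_eq_sum_propagator:
  assumes "cauchy_solution smul D A m y0 y"
  shows "y = (\<Sum>k<m. propagator k (y0 k))"
proof -
  obtain r where sol: "cauchy_solution_on smul D A m y0 r y"
    using assms by (auto simp: cauchy_solution_def)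
  have "(A ^^ (n div m)) (y0 (n mod m)) = smul (fact n) (fps_nth y n)" for n
    using funpow_initial_value[OF sol, of "n mod m" "n div m"] m_pos by simp
  then show ?thesis
    by (simp add: fps_eq_iff fps_nth_sum_propagator del: fps_sum_nth)
qed

text \<open>
  Entire vectors make the formal solution convergent; that it satisfies the equation is then the
  coefficient recursion.
\<close>

lemma sum_propagator_solution:
  assumes "\<And>k. k < m \<Longrightarrow> y0 k \<in> entire_vectors D A"
  shows "cauchy_solution smul D A m y0 (\<Sum>k<m. propagator k (y0 k))"
proof -
  let ?y = "\<Sum>k<m. propagator k (y0 k)"
  interpret S: vector_space "series_scale smul" by (rule vector_space_series)
  have "?y \<in> (\<Union>r\<in>{0<..}. analytic_space r)"
    by (intro S.subspace_sum subspace_locally_analytic propagator_mem_analytic_space assms) simp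
  then obtain r where r: "0 < r" "?y \<in> analytic_space r" by auto
  have dom: "(A ^^ i) (y0 (n mod m)) \<in> D" for i n
    using assms[of "n mod m"] m_pos by (simp add: entire_vector_funpow_mem)
  have "fps_nth ?y n \<in> D \<and> A (fps_nth ?y n) = fps_nth (series_deriv smul m ?y) n" for n
  proof
    show "fps_nth ?y n \<in> D"
      unfolding fps_nth_sum_propagator by (intro subspace_scale subspace_D dom)
    have "A (fps_nth ?y n) = smul (1 / fact n) ((A ^^ Suc (n div m)) (y0 (n mod m)))"
      unfolding fps_nth_sum_propagator by (simp add: A_smul dom)
    also have "\<dots> = smul (1 / fact n) (smul (fact (n + m)) (fps_nth ?y (n + m)))"
      unfolding fps_nth_sum_propagator using m_pos by (simp del: funpow.simps)
    also have "\<dots> = smul (1 / fact n) (smul (fact n) (fps_nth (series_deriv smul m ?y) n))"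
      by (simp only: smul_fact_series_deriv)
    finally show "A (fps_nth ?y n) = fps_nth (series_deriv smul m ?y) n" by simp
  qed
  moreover have "smul (fact k) (fps_nth ?y k) = y0 k" if "k < m" for k
    unfolding fps_nth_sum_propagator using that by simp
  ultimately have "cauchy_solution_on smul D A m y0 r ?y"
    using r by (simp add: cauchy_solution_on_iff)
  then show ?thesis by (auto simp: cauchy_solution_def)
qed

text \<open>
  The terms of \<open>F\<^sub>k(z;A) y\<^sub>k\<close> are those terms of the solution whose index is \<open>k\<close> modulo \<open>m\<close>. They tend to
  zero, hence are summable, on the whole disc on which the solution is given.
\<close>

lemma solution_representation:
  assumes sol: "cauchy_solution_on smul D A m y0 r y" and z: "unorm z < r"
  shows "\<And>k. k < m \<Longrightarrow> summable (F_term smul A m k z (y0 k))"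
    and "series_eval smul y z = (\<Sum>k<m. F_series smul A m k z (y0 k))"
proof -
  define a where "a n = smul (z ^ n) (fps_nth y n)" for n
  have r: "r > 0" "y \<in> analytic_space r"
    using sol by (auto simp: cauchy_solution_on_def)
  have F: "F_term smul A m k z (y0 k) n = a (m * n + k)" if "k < m" for k n
    by (simp add: F_term_def a_def funpow_initial_value[OF sol that])
  show sumF: "summable (F_term smul A m k z (y0 k))" if k: "k < m" for k
  proof (rule summable_if_unorm_tendsto_0)
    have "strict_mono (\<lambda>n. m * n + k)"
      using m_pos by (intro strict_monoI) simp
    from LIMSEQ_subseq_LIMSEQ[OF unorm_series_term_tendsto_0[OF r less_imp_le[OF z]] this]
    show "(\<lambda>n. unorm (F_term smul A m k z (y0 k) n)) \<longlonglongrightarrow> 0"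
      by (simp add: F[OF k] a_def o_def)
  qed
  have "(\<Sum>i<N * m. a i) = (\<Sum>k<m. \<Sum>n<N. F_term smul A m k z (y0 k) n)" for N
  proof -
    have "(\<Sum>i<N * m. a i) = (\<Sum>n<N. sum a {n * m..<n * m + m})"
      by (rule sum.nat_group[symmetric])
    also have "\<dots> = (\<Sum>n<N. \<Sum>k<m. a (m * n + k))"
      by (simp add: sum.atLeastLessThan_shift_0[of a] atLeast0LessThan mult.commute)
    also have "\<dots> = (\<Sum>n<N. \<Sum>k<m. F_term smul A m k z (y0 k) n)"
      by (simp add: F)
    finally show ?thesis by (subst sum.swap)
  qed
  moreover have "(\<lambda>N. \<Sum>k<m. \<Sum>n<N. F_term smul A m k z (y0 k) n)
      \<longlonglongrightarrow> (\<Sum>k<m. F_series smul A m k z (y0 k))"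
    unfolding F_series_def by (intro tendsto_sum summable_LIMSEQ sumF) simp
  ultimately have "(\<lambda>N. \<Sum>i<N * m. a i) \<longlonglongrightarrow> (\<Sum>k<m. F_series smul A m k z (y0 k))"
    by simp
  moreover have "(\<lambda>N. \<Sum>i<N * m. a i) \<longlonglongrightarrow> series_eval smul y z"
  proof -
    have "strict_mono (\<lambda>N. N * m)"
      using m_pos by (intro strict_monoI) simp
    moreover have "(\<lambda>N. \<Sum>i<N. a i) \<longlonglongrightarrow> series_eval smul y z"
      using series_sums[OF r less_imp_le[OF z]] by (simp add: sums_def a_def)
    ultimately show ?thesis
      using LIMSEQ_subseq_LIMSEQ[of "\<lambda>N. \<Sum>i<N. a i"] by (simp add: o_def)
  qed
  ultimately show "series_eval smul y z = (\<Sum>k<m. F_series smul A m k z (y0 k))"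
    using LIMSEQ_unique by blast
qed

end

section \<open>Continuous dependence on the initial data\<close>

lemma lc_nbhd0_add:
  fixes smul :: "'k::{field,ultranormed} \<Rightarrow> 'v::ab_group_add \<Rightarrow> 'v"
  assumes "vector_space smul" "unorm (1 :: 'k) = 1"
    and "lc_nbhd0 smul I V N U" "x \<in> U" "y \<in> U"
  shows "x + y \<in> U"
proof -
  interpret vector_space smul by fact
  have "smul 1 x + smul 1 y \<in> U"
    using assms(2-5) unfolding lc_nbhd0_def abs_convex_def by (metis order_refl)
  then show ?thesis by simp
qed

text \<open>
  Translates of basic neighbourhoods of zero are open, because such neighbourhoods are closed under
  addition. So convergence can be tested on them alone.
\<close>

lemma limitin_lc_inductive_limit_iff:
  fixes smul :: "'k::{field,ultranormed} \<Rightarrow> 'v::ab_group_add \<Rightarrow> 'v"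
  assumes "vector_space smul" "module.subspace smul (\<Union>i\<in>I. V i)" "unorm (1 :: 'k) = 1"
  shows "limitin (lc_inductive_limit smul I V N) f l F \<longleftrightarrow>
     l \<in> (\<Union>i\<in>I. V i) \<and> (\<forall>U. lc_nbhd0 smul I V N U \<longrightarrow> (\<forall>\<^sub>F i in F. f i - l \<in> U))"
    (is "limitin ?T f l F \<longleftrightarrow> l \<in> ?E \<and> ?R")
proof -
  interpret vector_space smul by fact
  have top: "topspace ?T = ?E"
    using lc_cocone_lc_inductive_limit[OF assms] by (simp add: lc_cocone_def)
  note add = lc_nbhd0_add[OF assms(1,3)]
  show ?thesis
  proof
    assume lim: "limitin ?T f l F"
    then have l: "l \<in> ?E" using top by (simp add: limitin_def)
    moreover have "\<forall>\<^sub>F i in F. f i - l \<in> U" if U: "lc_nbhd0 smul I V N U" for U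
    proof -
      have "U \<subseteq> ?E" "0 \<in> U" using U by (auto simp: lc_nbhd0_def abs_convex_def)
      then have "(+) l ` U \<subseteq> ?E"
        using subspace_add[OF assms(2) l] by blast
      moreover have "(+) x ` U \<subseteq> (+) l ` U" if "x \<in> (+) l ` U" for x
        using that add[OF U] by (auto simp: image_iff add.assoc)
      ultimately have "openin ?T ((+) l ` U)"
        using U unfolding openin_lc_inductive_limit by blast
      moreover have "l \<in> (+) l ` U" using \<open>0 \<in> U\<close> by force
      ultimately have "\<forall>\<^sub>F i in F. f i \<in> (+) l ` U"
        using lim by (auto simp: limitin_def)
      then show ?thesis by eventually_elim auto
    qed
    ultimately show "l \<in> ?E \<and> ?R" by blast
  next
    assume R: "l \<in> ?E \<and> ?R"
    have "\<forall>\<^sub>F i in F. f i \<in> S" if S: "openin ?T S" "l \<in> S" for S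
    proof -
      obtain U where U: "lc_nbhd0 smul I V N U" "(+) l ` U \<subseteq> S"
        using S unfolding openin_lc_inductive_limit by blast
      from R U(1) have "\<forall>\<^sub>F i in F. f i - l \<in> U" by blast
      then show ?thesis
      proof eventually_elim
        case (elim i)
        then have "l + (f i - l) \<in> (+) l ` U" by (rule imageI)
        then show ?case using U(2) by auto
      qed
    qed
    then show "limitin ?T f l F" using R top by (simp add: limitin_def)
  qed
qed

context p_adic_cauchy_problem
begin

text \<open>Continuity at zero of the propagators between the two inductive limits.\<close>

lemma lc_nbhd0_propagator_preimage:
  assumes U: "lc_nbhd0 (series_scale smul) {0<..} analytic_space analytic_norm U"
  shows "lc_nbhd0 smul {0<..} (exp_space D A) (exp_norm A)
           {x \<in> entire_vectors D A. propagator k x \<in> U}"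
proof -
  have conv: "0 \<in> U" "\<And>x y a b. x \<in> U \<Longrightarrow> y \<in> U \<Longrightarrow> unorm a \<le> 1 \<Longrightarrow> unorm b \<le> 1 \<Longrightarrow>
      series_scale smul a x + series_scale smul b y \<in> U"
    using U by (auto simp: lc_nbhd0_def abs_convex_def)
  have "propagator k 0 = 0"
    using propagator_diff[of 0 0 k] subspace_0[OF subspace_entire_vectors] by simp
  then have "abs_convex smul {x \<in> entire_vectors D A. propagator k x \<in> U}"
    unfolding abs_convex_def
    by (simp add: conv propagator_linear subspace_0[OF subspace_entire_vectors]
        subspace_add[OF subspace_entire_vectors] subspace_scale[OF subspace_entire_vectors])
  moreover have "\<exists>e>0. {x \<in> exp_space D A \<alpha>. exp_norm A \<alpha> x < e}
      \<subseteq> {x \<in> entire_vectors D A. propagator k x \<in> U}" if \<alpha>: "\<alpha> > 0" for \<alpha>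
  proof -
    obtain r where r: "0 < r" "\<And>x n. x \<in> exp_space D A \<alpha> \<Longrightarrow>
        unorm (fps_nth (propagator k x) n) * r ^ n \<le> exp_norm A \<alpha> x * (1 / 2) ^ n"
      using propagator_bound[OF \<alpha>] by metis
    obtain e where e: "e > 0" "{v \<in> analytic_space r. analytic_norm r v < e} \<subseteq> U"
      using U r(1) unfolding lc_nbhd0_def by (meson greaterThan_iff)
    have "propagator k x \<in> U" if x: "x \<in> exp_space D A \<alpha>" "exp_norm A \<alpha> x < e" for x
    proof -
      have "0 \<le> exp_norm A \<alpha> x"
        using order_trans[OF unorm_nonneg unorm_funpow_le_exp_norm[OF \<alpha> x(1), of 0]] by simp
      then have "exp_norm A \<alpha> x * (1 / 2) ^ n \<le> exp_norm A \<alpha> x" for n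
        by (intro mult_right_le_one_le power_le_one) auto
      then have "analytic_norm r (propagator k x) \<le> exp_norm A \<alpha> x"
        unfolding analytic_norm_def by (intro cSUP_least order_trans[OF r(2)[OF x(1)]]) auto
      moreover have "propagator k x \<in> analytic_space r"
        using r x(1) by (intro analytic_spaceI_geometric) auto
      ultimately show ?thesis using e(2) x(2) by auto
    qed
    then show ?thesis using e(1) \<alpha> by (intro exI[of _ e]) (auto simp: entire_vectors_def)
  qed
  ultimately show ?thesis
    by (auto simp: lc_nbhd0_def entire_vectors_def)
qed

lemma solution_depends_continuously:
  assumes y0: "\<And>k. k < m \<Longrightarrow> y0 k \<in> entire_vectors D A"
    and Y0: "\<And>i k. k < m \<Longrightarrow> Y0 i k \<in> entire_vectors D A"
    and lim: "\<And>k. k < m \<Longrightarrow> limitin (entire_vectors_topology smul D A) (\<lambda>i. Y0 i k) (y0 k) F"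
    and Y: "\<And>i. cauchy_solution smul D A m (Y0 i) (Y i)"
    and y: "cauchy_solution smul D A m y0 y"
  shows "limitin (locally_analytic_topology smul) Y y F"
proof -
  interpret S: vector_space "series_scale smul" by (rule vector_space_series)
  have "y \<in> (\<Union>r\<in>{0<..}. analytic_space r)"
    using y by (auto simp: cauchy_solution_def cauchy_solution_on_def)
  moreover have "\<forall>\<^sub>F i in F. Y i - y \<in> U"
    if U: "lc_nbhd0 (series_scale smul) {0<..} analytic_space analytic_norm U" for U
  proof -
    have E: "subspace (\<Union>\<alpha>\<in>{0<..}. exp_space D A \<alpha>)"
      using subspace_entire_vectors by (simp add: entire_vectors_def)
    have "\<forall>\<^sub>F i in F. Y0 i k - y0 k \<in> {x \<in> entire_vectors D A. propagator k x \<in> U}" if k: "k < m" for k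
      using lim[OF k] lc_nbhd0_propagator_preimage[OF U]
      unfolding entire_vectors_topology_def
        limitin_lc_inductive_limit_iff[OF vector_space_axioms E unorm_one] by blast
    then have "\<forall>\<^sub>F i in F. \<forall>k\<in>{..<m}. propagator k (Y0 i k - y0 k) \<in> U"
      by (intro eventually_ball_finite) (auto simp: eventually_conj_iff)
    then show ?thesis
    proof eventually_elim
      case (elim i)
      have "0 \<in> U" using U by (simp add: lc_nbhd0_def abs_convex_def)
      have sum_mem: "sum f K \<in> U" if "\<And>k. k \<in> K \<Longrightarrow> f k \<in> U" for f and K :: "nat set"
        using that
        by (induction K rule: infinite_finite_induct)
          (simp_all add: \<open>0 \<in> U\<close> lc_nbhd0_add[OF vector_space_series unorm_one U])
      have "(\<Sum>k<m. propagator k (Y0 i k - y0 k)) \<in> U" by (rule sum_mem) (use elim in simp)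
      also have "(\<Sum>k<m. propagator k (Y0 i k - y0 k)) = Y i - y"
        by (simp add: solution_eq_sum_propagator[OF Y] solution_eq_sum_propagator[OF y]
            propagator_diff y0 Y0 sum_subtractf)
      finally show ?case .
    qed
  qed
  ultimately show ?thesis
    unfolding locally_analytic_topology_def
      limitin_lc_inductive_limit_iff[OF vector_space_series subspace_locally_analytic unorm_one]
    by blast
qed

end

section \<open>Solvability and well-posedness\<close>

theorem theorem1:
  fixes p m :: nat
    and smul :: "'k::{field_char_0,ultranormed,complete_space} \<Rightarrow>
                  'b::{ultranormed,complete_space} \<Rightarrow> 'b"
    and D :: "'b set" and A :: "'b \<Rightarrow> 'b"
    and y0 :: "nat \<Rightarrow> 'b"
  assumes "Omega_p_banach_space p smul"
    and "closed_linear_operator smul D A"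
    and "m \<ge> 1"
  shows
    "((\<exists>y. cauchy_solution smul D A m y0 y) \<longleftrightarrow> (\<forall>k<m. y0 k \<in> entire_vectors D A)) \<and>
     (\<forall>r y. cauchy_solution_on smul D A m y0 r y \<longrightarrow>
        (\<forall>z. unorm z < r \<longrightarrow>
           (\<forall>k<m. summable (F_term smul A m k z (y0 k))) \<and>
           series_eval smul y z = (\<Sum>k<m. F_series smul A m k z (y0 k)))) \<and>
     (\<forall>y y'. cauchy_solution smul D A m y0 y \<longrightarrow> cauchy_solution smul D A m y0 y' \<longrightarrow> y = y') \<and>
     (\<forall>Y0 Y y.
        (\<forall>k<m. y0 k \<in> entire_vectors D A) \<longrightarrow>
        (\<forall>i. \<forall>k<m. Y0 i k \<in> entire_vectors D A) \<longrightarrow>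
        (\<forall>k<m. limitin (entire_vectors_topology smul D A) (\<lambda>i. Y0 i k) (y0 k) sequentially) \<longrightarrow>
        (\<forall>i. cauchy_solution smul D A m (Y0 i) (Y i)) \<longrightarrow>
        cauchy_solution smul D A m y0 y \<longrightarrow>
        limitin (locally_analytic_topology smul) Y y sequentially)"
proof -
  interpret Omega_p_banach_space p smul by fact
  interpret p_adic_cauchy_problem p smul D A m
    using assms(2,3) by unfold_locales
  have "(\<exists>y. cauchy_solution smul D A m y0 y) \<longleftrightarrow> (\<forall>k<m. y0 k \<in> entire_vectors D A)"
    using initial_value_entire sum_propagator_solution unfolding cauchy_solution_def by meson
  moreover have "\<forall>r y. cauchy_solution_on smul D A m y0 r y \<longrightarrow>
        (\<forall>z. unorm z < r \<longrightarrow>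
           (\<forall>k<m. summable (F_term smul A m k z (y0 k))) \<and>
           series_eval smul y z = (\<Sum>k<m. F_series smul A m k z (y0 k)))"
    using solution_representation by blast
  moreover have "\<forall>y y'. cauchy_solution smul D A m y0 y \<longrightarrow> cauchy_solution smul D A m y0 y' \<longrightarrow> y = y'"
    using solution_eq_sum_propagator by metis
  moreover have "limitin (locally_analytic_topology smul) Y y sequentially"
    if "\<forall>k<m. y0 k \<in> entire_vectors D A" "\<forall>i. \<forall>k<m. Y0 i k \<in> entire_vectors D A"
      "\<forall>k<m. limitin (entire_vectors_topology smul D A) (\<lambda>i. Y0 i k) (y0 k) sequentially"
      "\<forall>i. cauchy_solution smul D A m (Y0 i) (Y i)" "cauchy_solution smul D A m y0 y" for Y0 Y y
    by (rule solution_depends_continuously[of y0 Y0]) (use that in simp_all)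
  ultimately show ?thesis by (intro conjI allI impI) blast+
qed

end
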